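(* Let $T\in\mathcal{BC}(X)$. For all $s,p\in\rho_S(T)$ with $s\notin[p]$ the following equation holds: $$\mathcal Q_{c,s}(T)^{-1}S^{-1}_L(p,T)+S^{-1}_R(s,T)\mathcal Q_{c,p}(T)^{-1}-2\mathcal Q_{c,s}(T)^{-1}\,\underline T\,\mathcal Q_{c,p}(T)^{-1}$$ $$=\big[(\mathcal Q_{c,s}(T)^{-1}-\mathcal Q_{c,p}(T)^{-1})p-\bar s(\mathcal Q_{c,s}(T)^{-1}-\mathcal Q_{c,p}(T)^{-1})\big]\mathcal Q_s(p)^{-1},$$ where $\mathcal Q_s(p):=p^2-2s_0p+|s|^2$ and $\underline T=T_1e_1+T_2e_2+T_3e_3$.
   Context: $\mathbb H$ denotes the quaternions with units $e_1,e_2,e_3$; $s_0=\mathrm{Re}(s)$, and $[p]=\{p_0+J|\underline p| : J\in\mathbb S\}$ where $\underline p$ is the imaginary part of $p$ and $\mathbb S$ is the set of imaginary units ($J^2=-1$). $X=X_{\mathbb R}\otimes\mathbb H$ is a two-sided quaternionic Banach module, $X_{\mathbb R}$ a real Banach space; $\mathcal B(X)$ is the space of bounded right linear operators on $X$. For $a\in\mathbb H$ and $T\in\mathcal B(X)$, $(aT)(x)=a\,T(x)$ and $(Ta)(x)=T(ax)$. $\mathcal{BC}(X)\subset\mathcal B(X)$ is the set of operators $T=T_0+T_1e_1+T_2e_2+T_3e_3$ with pairwise commuting components $T_i\in\mathcal B(X_{\mathbb R})$; $\overline T=T_0-T_1e_1-T_2e_2-T_3e_3$. $S$-resolvent set: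 $\rho_S(T)=\{s\in\mathbb H: (T^2-2\mathrm{Re}(s)T+|s|^2\mathcal I)^{-1}\in\mathcal B(X)\}$. For $T\in\mathcal{BC}(X)$ it coincides with the set of $s\in\mathbb H$ for which $\mathcal Q_{c,s}(T):=s^2-s(T+\overline T)+T\overline T$ is invertible in $\mathcal B(X)$. For $s\in\rho_S(T)$: $S^{-1}_L(s,T)=(s\mathcal I-\overline T)\mathcal Q_{c,s}(T)^{-1}$, $S^{-1}_R(s,T)=\mathcal Q_{c,s}(T)^{-1}(s\mathcal I-\overline T)$. *)

theory Defs
  imports "HOL-Analysis.Analysis"
begin

text \<open>
  An element \<^term>\<open>Quat x0 x1 x2 x3\<close> of \<open>'a quat\<close> is $x_0 + x_1 e_1 + x_2 e_2 + x_3 e_3$, so that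
  \<open>'a quat\<close> is the tensor product of the real vector space \<open>'a\<close> with the quaternions. The
  quaternions themselves are \<open>real quat\<close>. On \<open>real quat\<close> the norm below is the modulus.
\<close>

datatype 'a quat = Quat (q0: 'a) (q1: 'a) (q2: 'a) (q3: 'a)

type_synonym quaternion = "real quat"

lemma quat_eq_iff: "x = y \<longleftrightarrow> q0 x = q0 y \<and> q1 x = q1 y \<and> q2 x = q2 y \<and> q3 x = q3 y"
  by (cases x; cases y) simp

instantiation quat :: (ab_group_add) ab_group_add
begin

definition "0 = Quat 0 0 0 0"
definition "x + y = Quat (q0 x + q0 y) (q1 x + q1 y) (q2 x + q2 y) (q3 x + q3 y)"
definition "x - y = Quat (q0 x - q0 y) (q1 x - q1 y) (q2 x - q2 y) (q3 x - q3 y)"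
definition "- x = Quat (- q0 x) (- q1 x) (- q2 x) (- q3 x)"

instance
  by standard (simp_all add: zero_quat_def plus_quat_def minus_quat_def uminus_quat_def quat_eq_iff)

end

lemma quat_sel_arith [simp]:
  "q0 0 = 0" "q1 0 = 0" "q2 0 = 0" "q3 0 = 0"
  "q0 (x + y) = q0 x + q0 y" "q1 (x + y) = q1 x + q1 y"
  "q2 (x + y) = q2 x + q2 y" "q3 (x + y) = q3 x + q3 y"
  "q0 (x - y) = q0 x - q0 y" "q1 (x - y) = q1 x - q1 y"
  "q2 (x - y) = q2 x - q2 y" "q3 (x - y) = q3 x - q3 y"
  "q0 (- x) = - q0 x" "q1 (- x) = - q1 x" "q2 (- x) = - q2 x" "q3 (- x) = - q3 x"
  by (simp_all add: zero_quat_def plus_quat_def minus_quat_def uminus_quat_def)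

instantiation quat :: (real_vector) real_vector
begin

definition "r *\<^sub>R x = Quat (r *\<^sub>R q0 x) (r *\<^sub>R q1 x) (r *\<^sub>R q2 x) (r *\<^sub>R q3 x)"

instance
  by standard (simp_all add: scaleR_quat_def quat_eq_iff algebra_simps)

end

lemma quat_sel_scaleR [simp]:
  "q0 (r *\<^sub>R x) = r *\<^sub>R q0 x" "q1 (r *\<^sub>R x) = r *\<^sub>R q1 x"
  "q2 (r *\<^sub>R x) = r *\<^sub>R q2 x" "q3 (r *\<^sub>R x) = r *\<^sub>R q3 x"
  by (simp_all add: scaleR_quat_def)

instantiation quat :: (real_normed_vector) real_normed_vector
begin

definition norm_quat :: "'a quat \<Rightarrow> real" where
  "norm_quat x = sqrt ((norm (q0 x))\<^sup>2 + (norm (q1 x))\<^sup>2 + (norm (q2 x))\<^sup>2 + (norm (q3 x))\<^sup>2)"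
definition dist_quat :: "'a quat \<Rightarrow> 'a quat \<Rightarrow> real" where "dist_quat x y = norm (x - y)"
definition sgn_quat :: "'a quat \<Rightarrow> 'a quat" where "sgn_quat x = x /\<^sub>R norm x"
definition uniformity_quat :: "('a quat \<times> 'a quat) filter" where
  "uniformity_quat = (INF e\<in>{0<..}. principal {(x, y :: 'a quat). dist x y < e})"
definition open_quat :: "'a quat set \<Rightarrow> bool" where
  "open_quat U \<longleftrightarrow> (\<forall>x\<in>U. \<forall>\<^sub>F (x', y) in uniformity. x' = x \<longrightarrow> y \<in> U)"

lemma norm_quat_tuple: "norm x = norm (q0 x, q1 x, q2 x, q3 x)"
  by (simp add: norm_quat_def norm_Pair)

instance
proof
  fix x y :: "'a quat" and r :: real
  show "norm x = 0 \<longleftrightarrow> x = 0"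
    by (simp add: norm_quat_tuple quat_eq_iff zero_prod_def)
  show "norm (x + y) \<le> norm x + norm y"
    using norm_triangle_ineq[of "(q0 x, q1 x, q2 x, q3 x)" "(q0 y, q1 y, q2 y, q3 y)"]
    by (simp add: norm_quat_tuple)
  show "norm (r *\<^sub>R x) = \<bar>r\<bar> * norm x"
    using norm_scaleR[of r "(q0 x, q1 x, q2 x, q3 x)"]
    by (simp add: norm_quat_tuple)
qed (rule dist_quat_def sgn_quat_def uniformity_quat_def open_quat_def)+

end

lemma norm_quat_sel_le:
  "norm (q0 x) \<le> norm x" "norm (q1 x) \<le> norm x" "norm (q2 x) \<le> norm x" "norm (q3 x) \<le> norm x"
  by (auto simp: norm_quat_def intro!: real_le_rsqrt)

lemma bounded_linear_quat_sel:
  "bounded_linear q0" "bounded_linear q1" "bounded_linear q2" "bounded_linear q3"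
  by (auto intro!: bounded_linear_intro[where K = 1] simp: norm_quat_sel_le)

lemma bounded_linear_Quat:
  assumes "bounded_linear f0" "bounded_linear f1" "bounded_linear f2" "bounded_linear f3"
  shows "bounded_linear (\<lambda>x. Quat (f0 x) (f1 x) (f2 x) (f3 x))"
proof -
  have "bounded_linear (\<lambda>x. (f0 x, f1 x, f2 x, f3 x))"
    by (intro bounded_linear_Pair assms)
  then obtain K where K: "\<And>x. norm (f0 x, f1 x, f2 x, f3 x) \<le> norm x * K"
    using bounded_linear.bounded by blast
  show ?thesis
    using assms[THEN bounded_linear.linear]
    by (intro bounded_linear_intro[where K = K])
      (simp_all add: quat_eq_iff linear_add linear_scale norm_quat_tuple K del: norm_Pair)
qed

instance quat :: (banach) banach
proof
  fix X :: "nat \<Rightarrow> 'a quat"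
  assume "Cauchy X"
  then have "Cauchy (\<lambda>n. q0 (X n))" "Cauchy (\<lambda>n. q1 (X n))"
    "Cauchy (\<lambda>n. q2 (X n))" "Cauchy (\<lambda>n. q3 (X n))"
    by (simp_all add: bounded_linear.Cauchy bounded_linear_quat_sel)
  then obtain a b c d where lims: "(\<lambda>n. q0 (X n)) \<longlonglongrightarrow> a" "(\<lambda>n. q1 (X n)) \<longlonglongrightarrow> b"
    "(\<lambda>n. q2 (X n)) \<longlonglongrightarrow> c" "(\<lambda>n. q3 (X n)) \<longlonglongrightarrow> d"
    by (meson Cauchy_convergent convergent_def)
  have "(\<lambda>n. norm ((q0 (X n), q1 (X n), q2 (X n), q3 (X n)) - (a, b, c, d))) \<longlonglongrightarrow> 0"
    using tendsto_Pair[OF lims(1) tendsto_Pair[OF lims(2) tendsto_Pair[OF lims(3,4)]]]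
    by (simp only: tendsto_norm_zero_iff LIM_zero_iff)
  then have "(\<lambda>n. norm (X n - Quat a b c d)) \<longlonglongrightarrow> 0"
    by (simp add: norm_quat_tuple del: norm_Pair)
  then have "X \<longlonglongrightarrow> Quat a b c d"
    by (simp only: tendsto_norm_zero_iff LIM_zero_iff)
  then show "convergent X"
    by (auto simp: convergent_def)
qed

instantiation quat :: (comm_ring_1) ring_1
begin

definition "1 = Quat 1 0 0 0"
definition "x * y = Quat
  (q0 x * q0 y - q1 x * q1 y - q2 x * q2 y - q3 x * q3 y)
  (q0 x * q1 y + q1 x * q0 y + q2 x * q3 y - q3 x * q2 y)
  (q0 x * q2 y - q1 x * q3 y + q2 x * q0 y + q3 x * q1 y)
  (q0 x * q3 y + q1 x * q2 y - q2 x * q1 y + q3 x * q0 y)"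

instance
  by standard (simp_all add: one_quat_def times_quat_def quat_eq_iff algebra_simps)

end

definition qcnj :: "'a::ab_group_add quat \<Rightarrow> 'a quat" where
  "qcnj x = Quat (q0 x) (- q1 x) (- q2 x) (- q3 x)"

instantiation quat :: (linordered_field) division_ring
begin

definition "inverse x = (let n = (q0 x)\<^sup>2 + (q1 x)\<^sup>2 + (q2 x)\<^sup>2 + (q3 x)\<^sup>2
  in Quat (q0 x / n) (- q1 x / n) (- q2 x / n) (- q3 x / n))"
definition "x div (y :: 'a quat) = x * inverse y"

instance
proof
  fix x y :: "'a quat"
  show "inverse x * x = 1" "x * inverse x = 1" if "x \<noteq> 0"
  proof -
    define n where "n = (q0 x)\<^sup>2 + (q1 x)\<^sup>2 + (q2 x)\<^sup>2 + (q3 x)\<^sup>2"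
    have "n \<noteq> 0"
      using that unfolding n_def
      by (auto simp: quat_eq_iff add_nonneg_eq_0_iff)
    moreover have "q0 x * q0 x + q1 x * q1 x + q2 x * q2 x + q3 x * q3 x = n"
      by (simp add: n_def power2_eq_square)
    ultimately have "q0 x * q0 x / n + q1 x * q1 x / n + q2 x * q2 x / n + q3 x * q3 x / n = 1"
      by (simp flip: add_divide_distrib)
    then show "inverse x * x = 1" "x * inverse x = 1"
      unfolding inverse_quat_def n_def[symmetric] Let_def
      by (simp_all add: quat_eq_iff one_quat_def times_quat_def mult.commute)
  qed
  show "x div y = x * inverse y"
    by (simp add: divide_quat_def)
  show "inverse 0 = (0 :: 'a quat)"
    by (simp add: inverse_quat_def quat_eq_iff)
qed

end

definition e1 :: quaternion where "e1 = Quat 0 1 0 0"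
definition e2 :: quaternion where "e2 = Quat 0 0 1 0"
definition e3 :: quaternion where "e3 = Quat 0 0 0 1"

lemma quaternion_units:
  "e1 * e1 = - 1" "e2 * e2 = - 1" "e3 * e3 = - 1"
  "e1 * e2 = e3" "e2 * e3 = e1" "e3 * e1 = e2"
  "e2 * e1 = - e3" "e3 * e2 = - e1" "e1 * e3 = - e2"
  by (simp_all add: e1_def e2_def e3_def one_quat_def times_quat_def quat_eq_iff)

definition of_base :: "'a::zero \<Rightarrow> 'a quat" where
  "of_base x = Quat x 0 0 0"

definition qvec :: "'a::zero quat \<Rightarrow> 'a quat" where
  "qvec x = Quat 0 (q1 x) (q2 x) (q3 x)"

definition imag_units :: "quaternion set" where
  "imag_units = {J. J\<^sup>2 = - 1}"

text \<open>The sphere $[p]$; \<^term>\<open>of_base\<close> embeds the reals into the quaternions.\<close>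

definition qsphere :: "quaternion \<Rightarrow> quaternion set" where
  "qsphere p = {of_base (q0 p) + J * of_base (norm (qvec p)) | J. J \<in> imag_units}"

text \<open>The left and right quaternionic module structures, given by the Hamilton product.\<close>

definition lact :: "quaternion \<Rightarrow> 'a::real_vector quat \<Rightarrow> 'a quat" where
  "lact a x = Quat
    (q0 a *\<^sub>R q0 x - q1 a *\<^sub>R q1 x - q2 a *\<^sub>R q2 x - q3 a *\<^sub>R q3 x)
    (q0 a *\<^sub>R q1 x + q1 a *\<^sub>R q0 x + q2 a *\<^sub>R q3 x - q3 a *\<^sub>R q2 x)
    (q0 a *\<^sub>R q2 x - q1 a *\<^sub>R q3 x + q2 a *\<^sub>R q0 x + q3 a *\<^sub>R q1 x)
    (q0 a *\<^sub>R q3 x + q1 a *\<^sub>R q2 x - q2 a *\<^sub>R q1 x + q3 a *\<^sub>R q0 x)"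

definition ract :: "'a::real_vector quat \<Rightarrow> quaternion \<Rightarrow> 'a quat" where
  "ract x a = Quat
    (q0 a *\<^sub>R q0 x - q1 a *\<^sub>R q1 x - q2 a *\<^sub>R q2 x - q3 a *\<^sub>R q3 x)
    (q1 a *\<^sub>R q0 x + q0 a *\<^sub>R q1 x + q3 a *\<^sub>R q2 x - q2 a *\<^sub>R q3 x)
    (q2 a *\<^sub>R q0 x - q3 a *\<^sub>R q1 x + q0 a *\<^sub>R q2 x + q1 a *\<^sub>R q3 x)
    (q3 a *\<^sub>R q0 x + q2 a *\<^sub>R q1 x - q1 a *\<^sub>R q2 x + q0 a *\<^sub>R q3 x)"

lemma lact_real: "lact a (x :: quaternion) = a * x"
  and ract_real: "ract (x :: quaternion) a = x * a"
  by (simp_all add: lact_def ract_def times_quat_def mult.commute)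

lemma lact_lact: "lact a (lact b x) = lact (a * b) x"
  and ract_ract: "ract (ract x a) b = ract x (a * b)"
  and lact_ract: "lact a (ract x b) = ract (lact a x) b"
  and lact_one: "lact 1 x = x"
  and ract_one: "ract x 1 = x"
  by (simp_all add: lact_def ract_def times_quat_def one_quat_def quat_eq_iff algebra_simps)

lemma lact_add: "lact (a + b) x = lact a x + lact b x" "lact a (x + y) = lact a x + lact a y"
  and ract_add: "ract x (a + b) = ract x a + ract x b" "ract (x + y) a = ract x a + ract y a"
  by (simp_all add: lact_def ract_def quat_eq_iff algebra_simps)

lemma lact_of_real: "lact (of_base r) x = r *\<^sub>R x"
  and ract_of_real: "ract x (of_base r) = r *\<^sub>R x"
  by (simp_all add: lact_def ract_def of_base_def quat_eq_iff)

lemma bounded_linear_lact: "bounded_linear (lact a)"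
  unfolding lact_def
  by (intro bounded_linear_Quat bounded_linear_add bounded_linear_sub
      bounded_linear_compose[OF bounded_linear_scaleR_right] bounded_linear_quat_sel)

lemma bounded_linear_ract: "bounded_linear (\<lambda>x. ract x a)"
  unfolding ract_def
  by (intro bounded_linear_Quat bounded_linear_add bounded_linear_sub
      bounded_linear_compose[OF bounded_linear_scaleR_right] bounded_linear_quat_sel)

text \<open>
  The Euclidean norm on \<open>'a quat\<close> is only one of the possible norms. Every norm that makes
  \<open>'a quat\<close> a two-sided quaternionic normed module extending the norm of \<open>'a\<close> is
  equivalent to it, hence yields the same bounded operators.
\<close>

lemma quaternionic_norm_equivalent:
  fixes N :: "'a::real_normed_vector quat \<Rightarrow> real"
  assumes triangle: "\<And>x y. N (x + y) \<le> N x + N y"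
    and left: "\<And>a x. N (lact a x) = norm a * N x"
    and right: "\<And>x a. N (ract x a) = N x * norm a"
    and base: "\<And>x. N (of_base x) = norm x"
  shows "N x \<le> 4 * norm x" and "norm x \<le> 4 * N x"
proof -
  have unit: "norm e1 = 1" "norm e2 = 1" "norm e3 = 1" "norm (- e1) = 1" "norm (- e2) = 1"
      "norm (- e3) = 1"
    by (simp_all add: norm_quat_def e1_def e2_def e3_def uminus_quat_def)
  have split: "x = of_base (q0 x) + (lact e1 (of_base (q1 x)) + (lact e2 (of_base (q2 x))
      + lact e3 (of_base (q3 x))))"
    by (simp add: quat_eq_iff lact_def of_base_def e1_def e2_def e3_def)
  have "N x \<le> N (of_base (q0 x)) + (N (lact e1 (of_base (q1 x))) + (N (lact e2 (of_base (q2 x)))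
      + N (lact e3 (of_base (q3 x)))))"
    by (subst split) (intro order_trans[OF triangle] add_mono order_refl)
  then show "N x \<le> 4 * norm x"
    using norm_quat_sel_le[of x] by (simp add: left unit base)
  have real_part: "norm (q0 y) \<le> N y" for y
  proof -
    have "of_base (4 *\<^sub>R q0 y) = y + (ract (lact (- e1) y) e1 + (ract (lact (- e2) y) e2
        + ract (lact (- e3) y) e3))"
      by (simp add: quat_eq_iff lact_def ract_def of_base_def e1_def e2_def e3_def)
        (simp add: scaleR_left_distrib[of 1 3, simplified] scaleR_left_distrib[of 1 2, simplified]
          scaleR_left_distrib[of 1 1, simplified])
    then have "N (of_base (4 *\<^sub>R q0 y)) \<le> N y + (N (ract (lact (- e1) y) e1)
        + (N (ract (lact (- e2) y) e2) + N (ract (lact (- e3) y) e3)))"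
      by (simp only:) (intro order_trans[OF triangle] add_mono order_refl)
    then show ?thesis
      by (simp add: left right unit base)
  qed
  have "norm (q1 x) \<le> N x" "norm (q2 x) \<le> N x" "norm (q3 x) \<le> N x"
    using real_part[of "lact e1 x"] real_part[of "lact e2 x"] real_part[of "lact e3 x"]
    by (simp_all add: left unit) (simp_all add: lact_def e1_def e2_def e3_def)
  moreover have "norm x \<le> norm (q0 x) + (norm (q1 x) + (norm (q2 x) + norm (q3 x)))"
    unfolding norm_quat_tuple
    by (intro order_trans[OF norm_Pair_le] add_mono order_refl)
  ultimately show "norm x \<le> 4 * N x"
    using real_part[of x] by linarith
qed

definition right_linear :: "('a::real_vector quat \<Rightarrow> 'a quat) \<Rightarrow> bool" where
  "right_linear T \<longleftrightarrow> (\<forall>x y. T (x + y) = T x + T y) \<and> (\<forall>x a. T (ract x a) = ract (T x) a)"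

text \<open>
  The bounded right linear operators on the tensor product. Real homogeneity is the case of a
  real scalar in \<^term>\<open>ract\<close>.
\<close>

typedef (overloaded) 'a qop =
  "{T :: 'a::banach quat \<Rightarrow> 'a quat. right_linear T \<and> (\<exists>K. \<forall>x. norm (T x) \<le> K * norm x)}"
  morphisms qapp Abs_qop
  by (rule exI[of _ "\<lambda>x. x"]) (auto simp: right_linear_def intro!: exI[of _ 1])

lemma qop_char: "right_linear T \<and> (\<exists>K. \<forall>x. norm (T x) \<le> K * norm x) \<longleftrightarrow>
    bounded_linear T \<and> (\<forall>x a. T (ract x a) = ract (T x) a)"
  unfolding right_linear_def
  by (auto simp: bounded_linear_axioms_def bounded_linear_def linear_add mult.commute
      intro!: linearI simp flip: ract_of_real)

setup_lifting type_definition_qop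

lemma qapp_bounded_linear: "bounded_linear (qapp T)"
  and qapp_ract: "qapp T (ract x a) = ract (qapp T x) a"
  using qapp[of T] qop_char[of "qapp T"] by auto

lemma qop_eqI: "(\<And>x. qapp S x = qapp T x) \<Longrightarrow> S = T"
  by (metis ext qapp_inject)

text \<open>Composition is the product of the ring of bounded right linear operators.\<close>

instantiation qop :: (banach) "{real_algebra, monoid_mult}"
begin

lift_definition zero_qop :: "'a qop" is "\<lambda>_. 0"
  unfolding qop_char by (simp add: ract_def quat_eq_iff)
lift_definition one_qop :: "'a qop" is "\<lambda>x. x"
  unfolding qop_char by simp
lift_definition plus_qop :: "'a qop \<Rightarrow> 'a qop \<Rightarrow> 'a qop" is "\<lambda>S T x. S x + T x"
  unfolding qop_char by (simp add: bounded_linear_add ract_add)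
lift_definition minus_qop :: "'a qop \<Rightarrow> 'a qop \<Rightarrow> 'a qop" is "\<lambda>S T x. S x - T x"
  unfolding qop_char
  by (simp add: bounded_linear_sub linear_diff[OF bounded_linear.linear[OF bounded_linear_ract]])
lift_definition uminus_qop :: "'a qop \<Rightarrow> 'a qop" is "\<lambda>T x. - T x"
  unfolding qop_char
  by (simp add: bounded_linear_minus linear_neg[OF bounded_linear.linear[OF bounded_linear_ract]])
lift_definition scaleR_qop :: "real \<Rightarrow> 'a qop \<Rightarrow> 'a qop" is "\<lambda>r T x. r *\<^sub>R T x"
  unfolding qop_char
  by (simp add: bounded_linear_compose[OF bounded_linear_scaleR_right]
      linear_scale[OF bounded_linear.linear[OF bounded_linear_ract]])
lift_definition times_qop :: "'a qop \<Rightarrow> 'a qop \<Rightarrow> 'a qop" is "\<lambda>S T x. S (T x)"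
  unfolding qop_char by (simp add: bounded_linear_compose)

instance
proof
  fix R S T :: "'a qop" and r :: real
  show "R * (S + T) = R * S + R * T"
    by (rule qop_eqI)
      (simp add: plus_qop.rep_eq times_qop.rep_eq linear_add bounded_linear.linear[OF qapp_bounded_linear])
  show "R * r *\<^sub>R S = r *\<^sub>R (R * S)"
    by (rule qop_eqI)
      (simp add: scaleR_qop.rep_eq times_qop.rep_eq linear_scale bounded_linear.linear[OF qapp_bounded_linear])
qed (rule qop_eqI; simp add: zero_qop.rep_eq one_qop.rep_eq plus_qop.rep_eq minus_qop.rep_eq
    uminus_qop.rep_eq scaleR_qop.rep_eq times_qop.rep_eq algebra_simps; fail)+

end

lift_definition lscale :: "quaternion \<Rightarrow> 'a::banach qop \<Rightarrow> 'a qop" (infixr "\<cdot>\<^sub>l" 75)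
  is "\<lambda>a T x. lact a (T x)"
  unfolding qop_char by (simp add: bounded_linear_compose[OF bounded_linear_lact] lact_ract)

lift_definition rscale :: "'a::banach qop \<Rightarrow> quaternion \<Rightarrow> 'a qop" (infixl "\<cdot>\<^sub>r" 75)
  is "\<lambda>T a x. T (lact a x)"
  unfolding qop_char by (simp add: bounded_linear_compose[OF _ bounded_linear_lact] lact_ract)

text \<open>The extension of an operator on the real space to the tensor product.\<close>

lift_definition ext_op :: "('a::banach \<Rightarrow>\<^sub>L 'a) \<Rightarrow> 'a qop"
  is "\<lambda>A x. Quat (blinfun_apply A (q0 x)) (blinfun_apply A (q1 x))
                  (blinfun_apply A (q2 x)) (blinfun_apply A (q3 x))"
  unfolding qop_char
  by (auto intro!: bounded_linear_Quat bounded_linear_compose[OF blinfun.bounded_linear_right]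
        bounded_linear_quat_sel
      simp: quat_eq_iff ract_def blinfun.add_right blinfun.diff_right blinfun.scaleR_right)

text \<open>
  Every bounded right linear operator is $T_0 + T_1 e_1 + T_2 e_2 + T_3 e_3$ for unique bounded
  operators $T_i$ on the real space; see \<open>components_unique\<close> below.
\<close>

definition of_components :: "('a::banach \<Rightarrow>\<^sub>L 'a) quat \<Rightarrow> 'a qop" where
  "of_components C = ext_op (q0 C) + ext_op (q1 C) \<cdot>\<^sub>r e1 + ext_op (q2 C) \<cdot>\<^sub>r e2 + ext_op (q3 C) \<cdot>\<^sub>r e3"

definition components :: "'a::banach qop \<Rightarrow> ('a \<Rightarrow>\<^sub>L 'a) quat" where
  "components T = (THE C. T = of_components C)"

lemma qapp_of_components_of_base:
  "qapp (of_components C) (of_base x) = Quat (blinfun_apply (q0 C) x) (blinfun_apply (q1 C) x)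
    (blinfun_apply (q2 C) x) (blinfun_apply (q3 C) x)"
  by (simp add: of_components_def plus_qop.rep_eq rscale.rep_eq ext_op.rep_eq of_base_def
      lact_def e1_def e2_def e3_def quat_eq_iff blinfun.zero_right)

lemma inj_of_components: "inj of_components"
proof (rule injI)
  fix C D :: "('a \<Rightarrow>\<^sub>L 'a) quat"
  assume "of_components C = of_components D"
  then show "C = D"
    using qapp_of_components_of_base[of C] qapp_of_components_of_base[of D]
    by (auto simp: quat_eq_iff intro!: blinfun_eqI)
qed

lemma surj_of_components: "surj of_components"
proof (rule surjI)
  fix T :: "'a qop"
  let ?C = "Quat (Blinfun (\<lambda>x. q0 (qapp T (of_base x)))) (Blinfun (\<lambda>x. q1 (qapp T (of_base x))))
    (Blinfun (\<lambda>x. q2 (qapp T (of_base x)))) (Blinfun (\<lambda>x. q3 (qapp T (of_base x))))"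
  have bl: "bounded_linear (\<lambda>x. f (qapp T (of_base x)))" if "bounded_linear f" for f :: "'a quat \<Rightarrow> 'a"
    unfolding of_base_def
    by (intro bounded_linear_compose[OF that] bounded_linear_compose[OF qapp_bounded_linear]
        bounded_linear_Quat bounded_linear_ident bounded_linear_zero)
  have base: "qapp (of_components ?C) (of_base x) = qapp T (of_base x)" for x
    unfolding qapp_of_components_of_base
    by (simp add: quat_eq_iff bounded_linear_Blinfun_apply bl bounded_linear_quat_sel)
  show "of_components ?C = T"
  proof (rule qop_eqI)
    fix x :: "'a quat"
    have x: "x = of_base (q0 x) + ract (of_base (q1 x)) e1 + ract (of_base (q2 x)) e2
        + ract (of_base (q3 x)) e3"
      by (simp add: quat_eq_iff ract_def of_base_def e1_def e2_def e3_def)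
    have "qapp (of_components ?C) (of_base a + ract (of_base b) e1 + ract (of_base c) e2
          + ract (of_base d) e3)
        = qapp T (of_base a + ract (of_base b) e1 + ract (of_base c) e2 + ract (of_base d) e3)"
      for a b c d
      by (simp only: qapp_ract base linear_add[OF bounded_linear.linear[OF qapp_bounded_linear]])
    from this[of "q0 x" "q1 x" "q2 x" "q3 x"] show "qapp (of_components ?C) x = qapp T x"
      by (simp only: x[symmetric])
  qed
qed

lemma components_unique: "\<exists>!C. T = of_components C"
  using inj_of_components surj_of_components by (metis injD surjD)

definition BC :: "'a::banach qop set" where
  "BC = {T. let C = components T in
     \<forall>A \<in> {q0 C, q1 C, q2 C, q3 C}. \<forall>B \<in> {q0 C, q1 C, q2 C, q3 C}. A o\<^sub>L B = B o\<^sub>L A}"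

definition op_cnj :: "'a::banach qop \<Rightarrow> 'a qop" where
  "op_cnj T = (let C = components T in
     ext_op (q0 C) - ext_op (q1 C) \<cdot>\<^sub>r e1 - ext_op (q2 C) \<cdot>\<^sub>r e2 - ext_op (q3 C) \<cdot>\<^sub>r e3)"

definition op_vec :: "'a::banach qop \<Rightarrow> 'a qop" where
  "op_vec T = (let C = components T in
     ext_op (q1 C) \<cdot>\<^sub>r e1 + ext_op (q2 C) \<cdot>\<^sub>r e2 + ext_op (q3 C) \<cdot>\<^sub>r e3)"

definition op_invertible :: "'a::banach qop \<Rightarrow> bool" where
  "op_invertible A \<longleftrightarrow> (\<exists>B. A * B = 1 \<and> B * A = 1)"

definition op_inv :: "'a::banach qop \<Rightarrow> 'a qop" where
  "op_inv A = (THE B. A * B = 1 \<and> B * A = 1)"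

lemma op_inv:
  assumes "op_invertible A"
  shows "A * op_inv A = 1" "op_inv A * A = 1"
proof -
  have "\<exists>!B. A * B = 1 \<and> B * A = 1"
  proof (rule ex_ex1I)
    show "\<exists>B. A * B = 1 \<and> B * A = 1"
      using assms unfolding op_invertible_def .
    fix B C
    assume "A * B = 1 \<and> B * A = 1" "A * C = 1 \<and> C * A = 1"
    then have "B * (A * C) = B" "(B * A) * C = C"
      by simp_all
    then show "B = C"
      by (simp add: mult.assoc)
  qed
  from theI'[OF this] show "A * op_inv A = 1" "op_inv A * A = 1"
    unfolding op_inv_def by auto
qed

definition S_resolvent_set :: "'a::banach qop \<Rightarrow> quaternion set" where
  "S_resolvent_set T = {s. op_invertible (T\<^sup>2 - (2 * q0 s) *\<^sub>R T + (norm s)\<^sup>2 *\<^sub>R 1)}"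

definition Qc :: "quaternion \<Rightarrow> 'a::banach qop \<Rightarrow> 'a qop" where
  "Qc s T = s\<^sup>2 \<cdot>\<^sub>l 1 - s \<cdot>\<^sub>l (T + op_cnj T) + T * op_cnj T"

definition SL_inv :: "quaternion \<Rightarrow> 'a::banach qop \<Rightarrow> 'a qop" where
  "SL_inv s T = (s \<cdot>\<^sub>l 1 - op_cnj T) * op_inv (Qc s T)"

definition SR_inv :: "quaternion \<Rightarrow> 'a::banach qop \<Rightarrow> 'a qop" where
  "SR_inv s T = op_inv (Qc s T) * (s \<cdot>\<^sub>l 1 - op_cnj T)"

definition Qq :: "quaternion \<Rightarrow> quaternion \<Rightarrow> quaternion" where
  "Qq s p = p\<^sup>2 - (2 * q0 s) *\<^sub>R p + of_base ((norm s)\<^sup>2)"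

end

theory Submission
  imports Defs
begin

text \<open>
  Left multiplications by quaternions commute with $T_0$ and $N = T \overline T$, so
  $Q_{c,s} = s^2 - 2 s T_0 + N$ commutes with $\overline s$ and $Q_{c,p}$ commutes with $p$ and
  $Q_s(p)$. Both sides of the equation reduce to
  $Q_{c,s}^{-1} (s + p - 2 T_0) Q_{c,p}^{-1}$: the left one because
  $\overline T = T_0 - \underline T$, the right one by
  $Q_{c,s}^{-1} - Q_{c,p}^{-1} = Q_{c,s}^{-1} (Q_{c,p} - Q_{c,s}) Q_{c,p}^{-1}$ and the identities
  $(p - s) p - \overline s (p - s) = Q_s(p)$ and
  $(p^2 - s^2) p - \overline s (p^2 - s^2) = (s + p) Q_s(p)$.
\<close>

section \<open>Left multiplications as elements of the operator ring\<close>

abbreviation lop :: "quaternion \<Rightarrow> 'a::banach qop" where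
  "lop a \<equiv> a \<cdot>\<^sub>l 1"

text \<open>Since $(aT)(x) = a T(x)$ and $(Ta)(x) = T(ax)$, both scalings become products with the
  same element \<open>lop a\<close>, and all later work is algebra in the ring of operators.\<close>

lemma lscale_eq: "a \<cdot>\<^sub>l T = lop a * T"
  and rscale_eq: "T \<cdot>\<^sub>r a = T * lop a"
  by (rule qop_eqI; simp add: lscale.rep_eq rscale.rep_eq times_qop.rep_eq one_qop.rep_eq)+

lemma lact_scaleR: "lact (r *\<^sub>R a) x = r *\<^sub>R lact a x"
  by (simp add: lact_def quat_eq_iff algebra_simps)

lemma lop_mult: "lop a * lop b = (lop (a * b) :: 'a::banach qop)"
  and lop_add: "lop (a + b) = (lop a + lop b :: 'a qop)"
  and lop_of_base: "lop (of_base r) = (r *\<^sub>R 1 :: 'a qop)"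
  and lop_scaleR: "lop (r *\<^sub>R a) = (r *\<^sub>R lop a :: 'a qop)"
  by (rule qop_eqI, simp add: lscale.rep_eq times_qop.rep_eq one_qop.rep_eq plus_qop.rep_eq
      scaleR_qop.rep_eq lact_lact lact_add lact_of_real lact_scaleR)+

lemma lop_minus: "lop (- a) = (- lop a :: 'a::banach qop)"
  using lop_scaleR[of "- 1" a] by simp

lemma lop_diff: "lop (a - b) = (lop a - lop b :: 'a::banach qop)"
  using lop_add[of a "- b"] by (simp add: lop_minus)

lemma lop_one: "lop 1 = (1 :: 'a::banach qop)"
  by (rule qop_eqI) (simp add: lscale.rep_eq one_qop.rep_eq lact_one)

text \<open>An extended operator applies one real linear map to each coordinate, while
  \<open>lact a\<close> only combines coordinates with real coefficients.\<close>

lemma ext_op_commute_lop: "ext_op A * lop a = lop a * ext_op A"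
  by (rule qop_eqI)
    (simp add: ext_op.rep_eq lscale.rep_eq times_qop.rep_eq one_qop.rep_eq lact_def quat_eq_iff
      blinfun.add_right blinfun.diff_right blinfun.scaleR_right)

lemma ext_op_compose: "ext_op (A o\<^sub>L B) = ext_op A * ext_op B"
  by (rule qop_eqI) (simp add: ext_op.rep_eq times_qop.rep_eq)

section \<open>Commutation and invertibility\<close>

lemma inverse_commute:
  fixes x y z :: "'b::monoid_mult"
  assumes "x * y = 1" "y * x = 1" "y * z = z * y"
  shows "x * z = z * x"
proof -
  have "x * z = x * (z * y) * x"
    using assms(1) by (simp add: mult.assoc assms(2))
  also have "\<dots> = z * x"
    by (simp add: assms flip: assms(3) mult.assoc)
  finally show ?thesis .
qed

lemma commute_mult:
  fixes x y z :: "'b::semigroup_mult"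
  shows commute_mult_right: "x * y = y * x \<Longrightarrow> x * z = z * x \<Longrightarrow> x * (y * z) = y * z * x"
    and commute_mult_left: "x * z = z * x \<Longrightarrow> y * z = z * y \<Longrightarrow> x * y * z = z * (x * y)"
  by (metis mult.assoc)+

lemma mult_swap_middle:
  fixes x y z w :: "'b::semigroup_mult"
  shows "y * z = z * y \<Longrightarrow> x * y * (z * w) = x * z * (y * w)"
  by (metis mult.assoc)

lemma op_inv_commute:
  assumes "op_invertible A" "A * B = B * A"
  shows "op_inv A * B = B * op_inv A"
  using inverse_commute[OF op_inv(2,1)] assms by blast

lemma op_invertible_mult:
  assumes "op_invertible A" "op_invertible B"
  shows "op_invertible (A * B)"
proof -
  have "A * B * (op_inv B * op_inv A) = A * (B * op_inv B) * op_inv A"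
    "op_inv B * op_inv A * (A * B) = op_inv B * (op_inv A * A) * B"
    by (simp_all add: mult.assoc)
  then show ?thesis
    using assms unfolding op_invertible_def[of "A * B"] by (auto simp: op_inv)
qed

text \<open>With Z the inverse of AB, BZ is a right inverse of A. Commutation makes ZB a left
  inverse, and the two must coincide.\<close>

lemma op_invertible_factor:
  assumes "op_invertible (A * B)" "A * B = B * A"
  shows "op_invertible A"
proof -
  let ?Z = "op_inv (A * B)"
  have "A * (B * ?Z) = 1"
    using op_inv(1)[OF assms(1)] by (simp add: mult.assoc)
  moreover have "?Z * B * A = 1"
    using op_inv(2)[OF assms(1)] assms(2) by (simp add: mult.assoc)
  moreover from calculation have "?Z * B = B * ?Z"
    by (metis mult.assoc mult_1_left mult_1_right)
  ultimately show ?thesis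
    unfolding op_invertible_def by metis
qed

section \<open>Quaternionic conjugation of operators\<close>

text \<open>
  Quaternionic conjugation $\overline x = -\frac12(x + \sum_i e_i x e_i)$, written without
  components so that it makes sense for all operators.
\<close>

definition qop_conj :: "'a::banach qop \<Rightarrow> 'a qop" where
  "qop_conj R = - (1/2) *\<^sub>R (R + lop e1 * R * lop e1 + lop e2 * R * lop e2 + lop e3 * R * lop e3)"

lemma lop_units:
  "lop e1 * lop e1 = (- 1 :: 'a::banach qop)" "lop e2 * lop e2 = (- 1 :: 'a qop)"
  "lop e3 * lop e3 = (- 1 :: 'a qop)"
  "lop e1 * lop e2 = (lop e3 :: 'a qop)" "lop e2 * lop e3 = (lop e1 :: 'a qop)"
  "lop e3 * lop e1 = (lop e2 :: 'a qop)"
  "lop e2 * lop e1 = (- lop e3 :: 'a qop)" "lop e3 * lop e2 = (- lop e1 :: 'a qop)"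
  "lop e1 * lop e3 = (- lop e2 :: 'a qop)"
  by (simp_all add: lop_mult quaternion_units lop_minus lop_one)

text \<open>The unit relations with a trailing factor, so that they still rewrite inside
  right-associated products.\<close>

lemma lop_units_assoc:
  "lop e1 * (lop e1 * x) = - x" "lop e2 * (lop e2 * x) = - x"
  "lop e3 * (lop e3 * x) = - x"
  "lop e1 * (lop e2 * x) = lop e3 * x" "lop e2 * (lop e3 * x) = lop e1 * x"
  "lop e3 * (lop e1 * x) = lop e2 * x"
  "lop e2 * (lop e1 * x) = - (lop e3 * x)" "lop e3 * (lop e2 * x) = - (lop e1 * x)"
  "lop e1 * (lop e3 * x) = - (lop e2 * x)"
  by (simp_all add: lop_units flip: mult.assoc)

lemma qop_conj_add: "qop_conj (R + S) = qop_conj R + qop_conj S"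
  by (simp add: qop_conj_def algebra_simps)

lemma qop_conj_one: "qop_conj 1 = 1"
proof -
  \<comment> \<open>For the identity the three sandwiched terms are the squares of the units, and
    the factor -1/2 normalizes the sum 1 - 3.\<close>
  have "(1 :: 'a qop) + - 1 + - 1 + - 1 = (- 2) *\<^sub>R 1"
    using scaleR_left_diff_distrib[of "1::real" 3 "1::'a qop"]
    by (simp add: scaleR_left_distrib[of 1 1, simplified] algebra_simps)
  then show ?thesis
    by (simp add: qop_conj_def lop_units)
qed

text \<open>Conjugation reverses a product with a unit, whose conjugate is its negative: the extra
  unit merely permutes the four summands up to sign.\<close>

lemma qop_conj_mult_unit:
  "qop_conj (R * lop e1) = - (lop e1 * qop_conj R)"
  "qop_conj (R * lop e2) = - (lop e2 * qop_conj R)"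
  "qop_conj (R * lop e3) = - (lop e3 * qop_conj R)"
  "qop_conj (lop e1 * R) = - (qop_conj R * lop e1)"
  "qop_conj (lop e2 * R) = - (qop_conj R * lop e2)"
  "qop_conj (lop e3 * R) = - (qop_conj R * lop e3)"
  by (simp_all add: qop_conj_def lop_units lop_units_assoc mult.assoc algebra_simps)

lemma qop_conj_mult_commuting:
  assumes "\<And>a. r * lop a = lop a * r"
  shows "qop_conj (r * R) = r * qop_conj R"
proof -
  have "lop a * (r * x) = r * (lop a * x)" for a x
    by (metis assms mult.assoc)
  then show ?thesis
    by (simp add: qop_conj_def mult.assoc distrib_left)
qed

text \<open>
  The inverse of the given operator need not have commuting components; its components only have
  to commute with those of the operator for conjugation to reverse the product.
\<close>

lemma op_invertible_conj:
  fixes r0 r1 r2 r3 :: "'a::banach qop"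
  assumes lop: "\<And>r a. r \<in> {r0, r1, r2, r3} \<Longrightarrow> r * lop a = lop a * r"
    and comm: "\<And>r r'. r \<in> {r0, r1, r2, r3} \<Longrightarrow> r' \<in> {r0, r1, r2, r3} \<Longrightarrow> r * r' = r' * r"
    and inv: "op_invertible (r0 + (r1 * lop e1 + r2 * lop e2 + r3 * lop e3))"
  shows "op_invertible (r0 - (r1 * lop e1 + r2 * lop e2 + r3 * lop e3))"
proof -
  let ?P = "r0 + (r1 * lop e1 + r2 * lop e2 + r3 * lop e3)"
  let ?P' = "r0 - (r1 * lop e1 + r2 * lop e2 + r3 * lop e3)"
  define R where "R = op_inv ?P"
  have rP: "r * ?P = ?P * r" if "r \<in> {r0, r1, r2, r3}" for r
  proof -
    have "r * (r' * lop a) = r' * lop a * r" if "r' \<in> {r0, r1, r2, r3}" for r' a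
      using comm[OF \<open>r \<in> _\<close> that] lop[OF \<open>r \<in> _\<close>] by (metis mult.assoc)
    then show ?thesis
      using comm[OF that, of r0] by (simp add: distrib_left distrib_right)
  qed
  have rR: "R * r = r * R" if "r \<in> {r0, r1, r2, r3}" for r
    unfolding R_def using op_inv_commute[OF inv] rP[OF that] by simp
  \<comment> \<open>Needed for the second one-sided inverse below, where the coefficients have to
    move past \<open>qop_conj R\<close>.\<close>
  have rK: "qop_conj R * r = r * qop_conj R" if "r \<in> {r0, r1, r2, r3}" for r
  proof -
    have "lop a * R * lop a * r = r * (lop a * R * lop a)" for a
      using lop[OF that, of a] rR[OF that] by (metis mult.assoc)
    then show ?thesis
      using rR[OF that] by (simp add: qop_conj_def distrib_left distrib_right)
  qed
  have K_mult: "qop_conj (r * X) = r * qop_conj X" if "r \<in> {r0, r1, r2, r3}" for r X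
    using lop[OF that] by (rule qop_conj_mult_commuting)
  \<comment> \<open>Conjugating RP = 1 flips the sign of every unit and swaps the factors, so P'
    appears on the left; PR = 1 then gives the other side.\<close>
  have "1 = qop_conj (R * ?P)"
    by (simp add: R_def op_inv inv qop_conj_one)
  also have "R * ?P = r0 * R + (r1 * (R * lop e1) + r2 * (R * lop e2) + r3 * (R * lop e3))"
    by (simp add: distrib_left rR flip: mult.assoc)
  also have "qop_conj \<dots> = ?P' * qop_conj R"
    by (simp add: qop_conj_add K_mult qop_conj_mult_unit
        left_diff_distrib distrib_right mult.assoc)
  finally have left: "?P' * qop_conj R = 1" ..
  have "1 = qop_conj (?P * R)"
    by (simp add: R_def op_inv inv qop_conj_one)
  also have "?P * R = r0 * R + (r1 * (lop e1 * R) + r2 * (lop e2 * R) + r3 * (lop e3 * R))"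
    by (simp add: distrib_right mult.assoc)
  also have "qop_conj \<dots> = r0 * qop_conj R
      - (r1 * qop_conj R * lop e1 + r2 * qop_conj R * lop e2 + r3 * qop_conj R * lop e3)"
    by (simp add: qop_conj_add K_mult qop_conj_mult_unit
        mult.assoc)
  also have "\<dots> = qop_conj R * ?P'"
    by (simp add: right_diff_distrib distrib_left flip: rK mult.assoc)
  finally have right: "qop_conj R * ?P' = 1" ..
  from left right show ?thesis
    unfolding op_invertible_def by blast
qed

section \<open>Zeros of $Q_s$ and identities between quaternions\<close>

lemma norm_quaternion_sq: "(norm (s :: quaternion))\<^sup>2 = (q0 s)\<^sup>2 + (q1 s)\<^sup>2 + (q2 s)\<^sup>2 + (q3 s)\<^sup>2"
  by (simp add: norm_quat_def)

lemma norm_quaternion_mult_self: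
  "norm (s :: quaternion) * norm s = q0 s * q0 s + q1 s * q1 s + q2 s * q2 s + q3 s * q3 s"
  using norm_quaternion_sq[of s] by (simp add: power2_eq_square)

text \<open>The vector part of $Q_s(p)$ is $2(p_0 - s_0)$ times that of p. If it vanishes, either p
  is real and the real part of $Q_s(p)$, a sum of squares, forces s = p, or $p_0 = s_0$ and the real
  part compares the lengths of the two vector parts.\<close>

lemma Qq_nonzero:
  assumes "s \<notin> qsphere p"
  shows "Qq s p \<noteq> 0"
proof
  define n where "n = norm (qvec p)"
  have n2: "n\<^sup>2 = (q1 p)\<^sup>2 + (q2 p)\<^sup>2 + (q3 p)\<^sup>2"
    by (simp add: n_def norm_quaternion_sq qvec_def)
  assume "Qq s p = 0"
  then have comps: "(q0 p - q0 s)\<^sup>2 - n\<^sup>2 + ((q1 s)\<^sup>2 + (q2 s)\<^sup>2 + (q3 s)\<^sup>2) = 0"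
    "(q0 p - q0 s) * q1 p = 0" "(q0 p - q0 s) * q2 p = 0" "(q0 p - q0 s) * q3 p = 0"
    unfolding n2
    by (auto simp: Qq_def quat_eq_iff norm_quaternion_mult_self of_base_def times_quat_def power2_eq_square
        algebra_simps)
  have "\<exists>J \<in> imag_units. s = of_base (q0 p) + J * of_base n"
  proof (cases "n = 0")
    case True
    have "q0 p = q0 s \<and> q1 s = 0 \<and> q2 s = 0 \<and> q3 s = 0"
      using comps(1) True by (auto simp: add_nonneg_eq_0_iff)
    \<comment> \<open>The sphere is a single point here, so any imaginary unit serves.\<close>
    then have "s = of_base (q0 p) + e1 * of_base n"
      using True by (simp add: quat_eq_iff times_quat_def of_base_def)
    moreover have "e1 \<in> imag_units"
      by (simp add: imag_units_def power2_eq_square quaternion_units)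
    ultimately show ?thesis by blast
  next
    case False
    have "q1 p \<noteq> 0 \<or> q2 p \<noteq> 0 \<or> q3 p \<noteq> 0"
      using False n2 by auto
    then have eq: "q0 p = q0 s"
      using comps by auto
    \<comment> \<open>The direction of the vector part of s, whose length is n.\<close>
    let ?J = "Quat 0 (q1 s / n) (q2 s / n) (q3 s / n)"
    have "(q1 s)\<^sup>2 + (q2 s)\<^sup>2 + (q3 s)\<^sup>2 = n\<^sup>2"
      using comps(1) eq by simp
    then have "(q1 s / n)\<^sup>2 + (q2 s / n)\<^sup>2 + (q3 s / n)\<^sup>2 = 1"
      using False by (simp add: power_divide flip: add_divide_distrib)
    then have "?J \<in> imag_units"
      by (simp add: imag_units_def power2_eq_square times_quat_def quat_eq_iff one_quat_def)
    moreover have "s = of_base (q0 p) + ?J * of_base n"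
      using False eq by (simp add: quat_eq_iff times_quat_def of_base_def)
    ultimately show ?thesis by blast
  qed
  with assms show False
    by (auto simp: qsphere_def n_def)
qed

lemma Qq_identities:
  "(p\<^sup>2 - s\<^sup>2) * p - qcnj s * (p\<^sup>2 - s\<^sup>2) = (s + p) * Qq s p"
  "(p - s) * p - qcnj s * (p - s) = Qq s p"
  by (simp_all add: quat_eq_iff Qq_def qcnj_def times_quat_def norm_quaternion_mult_self of_base_def
      power2_eq_square algebra_simps)

section \<open>Operators with commuting components\<close>

text \<open>Replaces the components by ring elements; later proofs use membership in
  \<open>BC\<close> only through these relations.\<close>

lemma BC_decomposition:
  fixes T :: "'a::banach qop"
  assumes "T \<in> BC"
  obtains t0 t1 t2 t3 :: "'a qop" where
    "\<And>r a. r \<in> {t0, t1, t2, t3} \<Longrightarrow> r * lop a = lop a * r"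
    "\<And>r r'. r \<in> {t0, t1, t2, t3} \<Longrightarrow> r' \<in> {t0, t1, t2, t3} \<Longrightarrow> r * r' = r' * r"
    "op_vec T = t1 * lop e1 + t2 * lop e2 + t3 * lop e3"
    "T = t0 + op_vec T" "op_cnj T = t0 - op_vec T"
proof -
  define C where "C = components T"
  let ?t0 = "ext_op (q0 C)" and ?t1 = "ext_op (q1 C)" and ?t2 = "ext_op (q2 C)"
    and ?t3 = "ext_op (q3 C)"
  have "T = of_components C"
    unfolding C_def components_def by (rule theI') (rule components_unique)
  moreover have vec: "op_vec T = ?t1 * lop e1 + ?t2 * lop e2 + ?t3 * lop e3"
    by (simp add: op_vec_def Let_def C_def rscale_eq[of "ext_op _"])
  ultimately have T: "T = ?t0 + op_vec T"
    by (simp add: of_components_def rscale_eq[of "ext_op _"] add.assoc)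
  have cnj: "op_cnj T = ?t0 - op_vec T"
    unfolding vec by (simp add: op_cnj_def Let_def C_def rscale_eq[of "ext_op _"])
  have comm: "r * r' = r' * r"
    if r: "r \<in> {?t0, ?t1, ?t2, ?t3}" and r': "r' \<in> {?t0, ?t1, ?t2, ?t3}" for r r'
  proof -
    obtain A where A: "A \<in> {q0 C, q1 C, q2 C, q3 C}" "r = ext_op A"
      using r by auto
    obtain B where B: "B \<in> {q0 C, q1 C, q2 C, q3 C}" "r' = ext_op B"
      using r' by auto
    have "A o\<^sub>L B = B o\<^sub>L A"
      using assms A(1) B(1) unfolding BC_def Let_def C_def by blast
    then show ?thesis
      by (simp add: A B flip: ext_op_compose)
  qed
  have "r * lop a = lop a * r" if "r \<in> {?t0, ?t1, ?t2, ?t3}" for r a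
    using that by (auto simp: ext_op_commute_lop)
  then show thesis
    using that comm vec T cnj by blast
qed

text \<open>The coefficients commute while distinct units anticommute, so the mixed terms cancel in
  pairs.\<close>

lemma pure_vector_square:
  fixes t1 t2 t3 :: "'a::banach qop"
  assumes lop: "\<And>r a. r \<in> {t1, t2, t3} \<Longrightarrow> r * lop a = lop a * r"
    and comm: "\<And>r r'. r \<in> {t1, t2, t3} \<Longrightarrow> r' \<in> {t1, t2, t3} \<Longrightarrow> r * r' = r' * r"
  shows "(t1 * lop e1 + t2 * lop e2 + t3 * lop e3) * (t1 * lop e1 + t2 * lop e2 + t3 * lop e3)
    = - (t1 * t1 + t2 * t2 + t3 * t3)"
proof -
  have *: "r * lop a * (r' * lop b) = r * r' * (lop a * lop b)" if "r' \<in> {t1, t2, t3}" for r r' a b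
    using lop[OF that, of a] by (metis mult.assoc)
  have "t2 * t1 = t1 * t2" "t3 * t1 = t1 * t3" "t3 * t2 = t2 * t3"
    using comm by auto
  then show ?thesis
    by (simp add: distrib_left distrib_right * lop_units)
qed

text \<open>With $c = b^2$ both sides expand to $c^2 + M^2 + m^2 + 2cM + 2mc - 2mM$, which is
  symmetric in M and m.\<close>

lemma sum_of_squares_swap:
  fixes b M :: "'b::{real_algebra,monoid_mult}"
  assumes "b * M = M * b"
  shows "(b * b - M + m *\<^sub>R 1) * (b * b - M + m *\<^sub>R 1) + 4 *\<^sub>R (b * b * M)
    = (b * b + M - m *\<^sub>R 1) * (b * b + M - m *\<^sub>R 1) + (4 * m) *\<^sub>R (b * b)"
proof -
  define c where "c = b * b"
  have "M * c = c * M"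
    unfolding c_def by (metis assms mult.assoc)
  moreover have "4 *\<^sub>R x = x + x + x + x" "(4 * m) *\<^sub>R x = m *\<^sub>R x + m *\<^sub>R x + m *\<^sub>R x + m *\<^sub>R x" for x :: 'b
    using scaleR_left_distrib[of 2 2 x] scaleR_left_distrib[of "2 * m" "2 * m" x]
      scaleR_left_distrib[of m m x]
    by (simp_all add: scaleR_2 add.assoc)
  ultimately show ?thesis
    unfolding c_def[symmetric] by (simp add: algebra_simps)
qed

section \<open>Invertibility of $Q_{c,s}(T)$ on the S-resolvent set\<close>

text \<open>
  With $b = T_0 - s_0$ and $M = T_1^2 + T_2^2 + T_3^2$ the two quadratic operators are
  $(b + \underline T)^2 + |\underline s|^2$ and $(b - \underline s)^2 + M$, and they have the same
  product with their conjugates.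
\<close>

lemma Qc_invertible:
  fixes T :: "'a::banach qop"
  assumes T: "T \<in> BC" and s: "s \<in> S_resolvent_set T"
  shows "op_invertible (Qc s T)"
proof -
  obtain t0 t1 t2 t3 :: "'a qop" where
    lop: "\<And>r a. r \<in> {t0, t1, t2, t3} \<Longrightarrow> r * lop a = lop a * r" and
    comm: "\<And>r r'. r \<in> {t0, t1, t2, t3} \<Longrightarrow> r' \<in> {t0, t1, t2, t3} \<Longrightarrow> r * r' = r' * r" and
    V: "op_vec T = t1 * lop e1 + t2 * lop e2 + t3 * lop e3" and
    T_eq: "T = t0 + op_vec T" and cnj: "op_cnj T = t0 - op_vec T"
    using BC_decomposition[OF T] by blast
  define V where "V = op_vec T"
  define b where "b = t0 - q0 s *\<^sub>R 1"
  define M where "M = t1 * t1 + t2 * t2 + t3 * t3"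
  define S where "S = (lop (qvec s) :: 'a qop)"
  define m where "m = (norm (qvec s))\<^sup>2"
  \<comment> \<open>The scalar parts of the two quadratics, which will turn out to be x + 2bV and y
    - 2bS.\<close>
  define x where "x = b * b - M + m *\<^sub>R 1"
  define y where "y = b * b + M - m *\<^sub>R 1"
  have VV: "V * V = - M"
    unfolding V_def V M_def by (rule pure_vector_square) (use lop comm in auto)
  then have "M = - (V * V)"
    by simp
  then have MV: "M * V = V * M"
    by (simp add: mult.assoc)
  have SS: "S * S = - (m *\<^sub>R 1)"
  proof -
    have "qvec s * qvec s = - of_base m"
      by (simp add: m_def norm_quaternion_mult_self qvec_def times_quat_def quat_eq_iff of_base_def
          power2_eq_square)
    then show ?thesis
      by (simp add: S_def lop_mult lop_minus lop_of_base)
  qed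
  have b_lop: "b * lop a = lop a * b" for a
    using lop[of t0 a] by (simp add: b_def algebra_simps)
  have bt: "b * t = t * b" if "t \<in> {t0, t1, t2, t3}" for t
    using comm[of t0 t] that by (simp add: b_def algebra_simps)
  have tt: "b * (t * t) = t * t * b" if "t \<in> {t0, t1, t2, t3}" for t
    by (intro commute_mult_right bt that)
  have bM: "b * M = M * b"
    using tt by (simp add: M_def distrib_left distrib_right)
  have "b * (t * lop a) = t * lop a * b" if "t \<in> {t0, t1, t2, t3}" for t a
    by (intro commute_mult_right bt that b_lop)
  then have bV: "b * V = V * b"
    by (simp add: V_def V distrib_left distrib_right)
  have tS: "t * t * S = S * (t * t)" if "t \<in> {t0, t1, t2, t3}" for t
    unfolding S_def by (intro commute_mult_left lop that)
  have MS: "M * S = S * M"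
    using tS by (simp add: M_def distrib_left distrib_right)
  have bS: "b * S = S * b"
    unfolding S_def by (rule b_lop)

  have T_bV: "T = q0 s *\<^sub>R 1 + b + V"
    using T_eq by (simp add: b_def V_def)
  have norm_s: "(norm s)\<^sup>2 = (q0 s)\<^sup>2 + m"
    by (simp add: m_def norm_quaternion_sq qvec_def)
  have two: "2 *\<^sub>R z = z + z" "(2 * r) *\<^sub>R z = r *\<^sub>R z + r *\<^sub>R z" for r and z :: "'a qop"
    using scaleR_left_distrib[of r r z] by (simp_all add: scaleR_2)
  have P: "T\<^sup>2 - (2 * q0 s) *\<^sub>R T + (norm s)\<^sup>2 *\<^sub>R 1 = x + 2 *\<^sub>R (b * V)"
    unfolding norm_s T_bV x_def two using VV bV
    by (simp add: power2_eq_square algebra_simps)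
  have lop_s: "(lop s :: 'a qop) = q0 s *\<^sub>R 1 + S"
  proof -
    have "s = of_base (q0 s) + qvec s"
      by (simp add: quat_eq_iff of_base_def qvec_def)
    then have "(lop s :: 'a qop) = lop (of_base (q0 s) + qvec s)"
      by simp
    then show ?thesis
      by (simp add: S_def lop_add lop_of_base)
  qed
  have Q: "Qc s T = y - 2 *\<^sub>R (b * S)"
  proof -
    have "lop (s\<^sup>2) = (lop s * lop s :: 'a qop)"
      by (simp add: lop_mult power2_eq_square)
    moreover have "T + op_cnj T = t0 + t0"
      using T_eq cnj by (metis add.assoc diff_add_cancel add.commute)
    moreover have "T * op_cnj T = t0 * t0 + M"
    proof -
      have t0V: "t0 * V = V * t0"
        using bV by (simp add: b_def algebra_simps)
      have "T * op_cnj T = (t0 + V) * (t0 - V)"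
        using T_eq cnj by (simp add: V_def)
      then show ?thesis
        using t0V VV by (simp add: algebra_simps)
    qed
    moreover have "t0 = q0 s *\<^sub>R 1 + b"
      by (simp add: b_def)
    ultimately show ?thesis
      unfolding Qc_def lscale_eq[of s "T + _"] lop_s y_def two using SS bS
      by (simp add: algebra_simps)
  qed

  have "op_invertible (x + 2 *\<^sub>R (b * V))"
    using s P by (simp add: S_resolvent_set_def)
  have bV_sum: "2 *\<^sub>R (b * V) = 2 *\<^sub>R (b * t1) * lop e1 + 2 *\<^sub>R (b * t2) * lop e2
      + 2 *\<^sub>R (b * t3) * lop e3"
    by (simp add: V_def V algebra_simps)
  \<comment> \<open>Conjugation with coefficients x and $2 b T_i$ flips the sign of V.\<close>
  have inv': "op_invertible (x - 2 *\<^sub>R (b * V))"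
  proof -
    have bt_lop: "b * t * lop a = lop a * (b * t)" if "t \<in> {t0, t1, t2, t3, b}" for t a
      using that lop[of t a] b_lop[of a] by (intro commute_mult_left) auto
    have x_lop: "x * lop a = lop a * x" for a
    proof -
      have "t * t * lop a = lop a * (t * t)" if "t \<in> {t0, t1, t2, t3}" for t
        by (intro commute_mult_left lop that)
      then show ?thesis
        using bt_lop[of b a] by (simp add: x_def M_def algebra_simps)
    qed
    have b_comm: "b * t * (b * t') = b * t' * (b * t)"
      if "t \<in> {t0, t1, t2, t3}" "t' \<in> {t0, t1, t2, t3}" for t t'
      by (intro commute_mult comm bt bt[symmetric] that refl)
    have Mt: "M * t = t * M" if "t \<in> {t0, t1, t2, t3}" for t
    proof -
      have "t' * t' * t = t * (t' * t')" if "t' \<in> {t0, t1, t2, t3}" for t'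
        by (intro commute_mult_left comm that \<open>t \<in> _\<close>)
      then show ?thesis
        by (simp add: M_def algebra_simps)
    qed
    have x_comm: "x * (b * t) = b * t * x" if "t \<in> {t0, t1, t2, t3}" for t
    proof -
      have "b * b * (b * t) = b * t * (b * b)" "M * (b * t) = b * t * M"
        by (intro commute_mult bt bt[symmetric] Mt bM bM[symmetric] that refl)+
      then show ?thesis
        by (simp add: x_def left_diff_distrib right_diff_distrib distrib_left distrib_right)
    qed
    show ?thesis
      unfolding bV_sum
    proof (rule op_invertible_conj)
      show "op_invertible (x + (2 *\<^sub>R (b * t1) * lop e1 + 2 *\<^sub>R (b * t2) * lop e2
          + 2 *\<^sub>R (b * t3) * lop e3))"
        using \<open>op_invertible (x + 2 *\<^sub>R (b * V))\<close> unfolding bV_sum .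
    qed (use x_lop bt_lop x_comm b_comm in auto)
  qed
  have bV_bV: "b * V * (b * V) = - (b * b * M)"
    by (simp add: mult_swap_middle[OF bV[symmetric]] VV)
  have bS_bS: "b * S * (b * S) = - (m *\<^sub>R (b * b))"
    by (simp add: mult_swap_middle[OF bS[symmetric]] SS)
  have x_bV: "x * (b * V) = b * V * x"
  proof -
    have "b * b * (b * V) = b * V * (b * b)" "M * (b * V) = b * V * M"
      by (intro commute_mult bV bV[symmetric] bM[symmetric] MV refl)+
    then show ?thesis
      by (simp add: x_def left_diff_distrib right_diff_distrib distrib_left distrib_right)
  qed
  have y_bS: "y * (b * S) = b * S * y"
  proof -
    have "b * b * (b * S) = b * S * (b * b)" "M * (b * S) = b * S * M"
      by (intro commute_mult bS bS[symmetric] bM[symmetric] MS refl)+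
    then show ?thesis
      by (simp add: y_def left_diff_distrib right_diff_distrib distrib_left distrib_right)
  qed
  \<comment> \<open>Each quadratic times its conjugate: $V^2 = -M$ yields $x^2 + 4 b^2 M$, and $S^2
    = -m$ yields $y^2 + 4 m b^2$.\<close>
  have "(x + 2 *\<^sub>R (b * V)) * (x - 2 *\<^sub>R (b * V)) = x * x + 4 *\<^sub>R (b * b * M)"
    by (simp add: distrib_right right_diff_distrib x_bV bV_bV scaleR_diff_right)
  also have "\<dots> = y * y + (4 * m) *\<^sub>R (b * b)"
    unfolding x_def y_def by (rule sum_of_squares_swap[OF bM])
  also have "\<dots> = (y - 2 *\<^sub>R (b * S)) * (y + 2 *\<^sub>R (b * S))"
    by (simp add: distrib_left left_diff_distrib y_bS bS_bS scaleR_diff_right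
        scaleR_add_right)
  finally have prod: "(x + 2 *\<^sub>R (b * V)) * (x - 2 *\<^sub>R (b * V))
    = (y - 2 *\<^sub>R (b * S)) * (y + 2 *\<^sub>R (b * S))" .
  show ?thesis
    unfolding Q
  \<comment> \<open>The common product is invertible by its first factorization; in the second,
    $Q_{c,s}$ is a factor commuting with its cofactor.\<close>
  proof (rule op_invertible_factor)
    show "op_invertible ((y - 2 *\<^sub>R (b * S)) * (y + 2 *\<^sub>R (b * S)))"
      unfolding prod[symmetric]
      by (intro op_invertible_mult inv' \<open>op_invertible (x + 2 *\<^sub>R (b * V))\<close>)
    show "(y - 2 *\<^sub>R (b * S)) * (y + 2 *\<^sub>R (b * S)) = (y + 2 *\<^sub>R (b * S)) * (y - 2 *\<^sub>R (b * S))"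
      by (simp add: distrib_left distrib_right left_diff_distrib right_diff_distrib y_bS
          scaleR_add_right scaleR_diff_right)
  qed
qed

section \<open>The resolvent equation\<close>

theorem theorem6p3:
  fixes T :: "'a::banach qop" and s p :: quaternion
  assumes "T \<in> BC"
    and "s \<in> S_resolvent_set T" and "p \<in> S_resolvent_set T"
    and "s \<notin> qsphere p"
  shows "op_inv (Qc s T) * SL_inv p T + SR_inv s T * op_inv (Qc p T)
      - 2 *\<^sub>R (op_inv (Qc s T) * op_vec T * op_inv (Qc p T))
    = ((op_inv (Qc s T) - op_inv (Qc p T)) \<cdot>\<^sub>r p - qcnj s \<cdot>\<^sub>l (op_inv (Qc s T) - op_inv (Qc p T)))
        \<cdot>\<^sub>r inverse (Qq s p)"
proof -
  obtain t0 t1 t2 t3 :: "'a qop" where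
    lop: "\<And>r a. r \<in> {t0, t1, t2, t3} \<Longrightarrow> r * lop a = lop a * r" and
    comm: "\<And>r r'. r \<in> {t0, t1, t2, t3} \<Longrightarrow> r' \<in> {t0, t1, t2, t3} \<Longrightarrow> r * r' = r' * r" and
    V: "op_vec T = t1 * lop e1 + t2 * lop e2 + t3 * lop e3" and
    T_eq: "T = t0 + op_vec T" and cnj: "op_cnj T = t0 - op_vec T"
    using BC_decomposition[OF assms(1)] by blast
  define N where "N = T * op_cnj T"
  define A where "A = op_inv (Qc s T)"
  define B where "B = op_inv (Qc p T)"
  have t0_lop: "t0 * lop a = lop a * t0" for a
    by (rule lop) simp
  have N_eq: "N = t0 * t0 + (t1 * t1 + t2 * t2 + t3 * t3)"
  proof -
    have "t0 * (t * lop a) = t * lop a * t0" if "t \<in> {t1, t2, t3}" for t a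
      using comm[of t0 t] that lop[of t0 a] by (metis insert_iff mult.assoc)
    then have "t0 * op_vec T = op_vec T * t0"
      by (simp add: V distrib_left distrib_right)
    moreover have "op_vec T * op_vec T = - (t1 * t1 + t2 * t2 + t3 * t3)"
      unfolding V by (rule pure_vector_square) (use lop comm in auto)
    moreover have "N = (t0 + op_vec T) * (t0 - op_vec T)"
      using T_eq cnj by (simp add: N_def)
    ultimately show ?thesis
      by (simp add: distrib_right right_diff_distrib)
  qed
  have N_lop: "N * lop a = lop a * N" for a
  proof -
    have "t * t * lop a = lop a * (t * t)" if "t \<in> {t0, t1, t2, t3}" for t
      using lop[OF that, of a] by (metis mult.assoc)
    then show ?thesis
      by (simp add: N_eq distrib_left distrib_right)
  qed
  have Qc: "Qc r T = lop (r\<^sup>2) - 2 *\<^sub>R (lop r * t0) + N" for r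
  proof -
    have "T + op_cnj T = t0 + t0"
      using T_eq cnj by (metis add.assoc diff_add_cancel add.commute)
    then show ?thesis
      by (simp add: scaleR_2 Qc_def N_def lscale_eq[of r "t0 + _"] algebra_simps)
  qed
  \<comment> \<open>As a polynomial in r with coefficients $T_0$ and N that commute with all left
    multiplications, $Q_{c,r}$ commutes with whatever commutes with r.\<close>
  have Qc_lop: "Qc r T * lop a = lop a * Qc r T" if "r * a = a * r" for r a
  proof -
    have "r\<^sup>2 * a = a * r\<^sup>2"
      using that by (metis mult.assoc power2_eq_square)
    moreover have "lop r * t0 * lop a = lop a * (lop r * t0)"
      by (metis lop_mult mult.assoc t0_lop that)
    ultimately show ?thesis
      by (simp add: Qc lop_mult N_lop left_diff_distrib right_diff_distrib distrib_left distrib_right)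
  qed
  have inv_s: "op_invertible (Qc s T)" and inv_p: "op_invertible (Qc p T)"
    using Qc_invertible assms by blast+
  have A: "Qc s T * A = 1" "A * Qc s T = 1" and B: "Qc p T * B = 1" "B * Qc p T = 1"
    by (simp_all add: A_def B_def op_inv inv_s inv_p)
  have A_lop: "A * lop (qcnj s) = lop (qcnj s) * A"
  proof -
    have "s * qcnj s = qcnj s * s"
      by (simp add: qcnj_def times_quat_def quat_eq_iff)
    then show ?thesis
      unfolding A_def by (intro op_inv_commute inv_s Qc_lop)
  qed
  have B_p: "B * lop p = lop p * B"
    unfolding B_def by (intro op_inv_commute inv_p Qc_lop) simp
  have B_Qq: "B * lop (Qq s p) = lop (Qq s p) * B"
  proof -
    have "p * Qq s p = Qq s p * p"
      by (simp add: Qq_def times_quat_def quat_eq_iff of_base_def power2_eq_square algebra_simps)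
    then show ?thesis
      unfolding B_def by (intro op_inv_commute inv_p Qc_lop)
  qed
  define D where "D = Qc p T - Qc s T"
  have AB: "A - B = A * D * B"
  proof -
    have "A * D * B = A * (Qc p T * B) - A * Qc s T * B"
      by (simp add: D_def algebra_simps mult.assoc)
    then show ?thesis
      by (simp add: A B)
  qed
  \<comment> \<open>N cancels, leaving only terms of degree at most one in $T_0$.\<close>
  have D: "D = lop (p\<^sup>2 - s\<^sup>2) - 2 *\<^sub>R (lop (p - s) * t0)"
    by (simp add: D_def Qc lop_diff algebra_simps)
  have "D * lop p - lop (qcnj s) * D
      = lop ((p\<^sup>2 - s\<^sup>2) * p - qcnj s * (p\<^sup>2 - s\<^sup>2))
        - 2 *\<^sub>R (lop ((p - s) * p - qcnj s * (p - s)) * t0)"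
  proof -
    have "lop (p - s) * t0 * lop p = lop (p - s) * lop p * t0"
      by (metis mult.assoc t0_lop)
    moreover have "lop (qcnj s) * (lop (p - s) * t0) = lop (qcnj s) * lop (p - s) * t0"
      by (simp add: mult.assoc)
    ultimately have "D * lop p - lop (qcnj s) * D
      = lop (p\<^sup>2 - s\<^sup>2) * lop p - lop (qcnj s) * lop (p\<^sup>2 - s\<^sup>2)
        - 2 *\<^sub>R ((lop (p - s) * lop p - lop (qcnj s) * lop (p - s)) * t0)"
      unfolding D by (simp add: left_diff_distrib right_diff_distrib scaleR_diff_right)
    then show ?thesis
      by (simp only: lop_mult flip: lop_diff)
  qed
  \<comment> \<open>Moving $T_0$ past $Q_s(p)$ makes the latter a common right factor.\<close>
  also have "\<dots> = (lop s + lop p - 2 *\<^sub>R t0) * lop (Qq s p)"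
    unfolding Qq_identities by (simp add: t0_lop left_diff_distrib flip: lop_mult lop_add)
  finally have key: "D * lop p - lop (qcnj s) * D = (lop s + lop p - 2 *\<^sub>R t0) * lop (Qq s p)" .
  have "(A - B) * lop p - lop (qcnj s) * (A - B) = A * (D * lop p - lop (qcnj s) * D) * B"
  proof -
    have "A * D * B * lop p = A * (D * lop p) * B"
      by (simp add: B_p mult.assoc)
    moreover have "lop (qcnj s) * (A * D * B) = A * (lop (qcnj s) * D) * B"
      by (simp flip: A_lop mult.assoc)
    ultimately show ?thesis
      by (simp add: AB right_diff_distrib left_diff_distrib)
  qed
  also have "\<dots> = A * (lop s + lop p - 2 *\<^sub>R t0) * B * lop (Qq s p)"
    unfolding key by (simp add: B_Qq mult.assoc)
  finally have "((A - B) * lop p - lop (qcnj s) * (A - B)) * lop (inverse (Qq s p))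
      = A * (lop s + lop p - 2 *\<^sub>R t0) * B * (lop (Qq s p) * lop (inverse (Qq s p)))"
    by (simp add: mult.assoc)
  also have "lop (Qq s p) * lop (inverse (Qq s p)) = (1 :: 'a qop)"
    using Qq_nonzero[OF assms(4)] by (simp add: lop_mult lop_one)
  finally have rhs: "((A - B) * lop p - lop (qcnj s) * (A - B)) * lop (inverse (Qq s p))
      = A * (lop s + lop p - 2 *\<^sub>R t0) * B"
    by simp
  have "A * ((lop p - op_cnj T) * B) + A * (lop s - op_cnj T) * B - 2 *\<^sub>R (A * op_vec T * B)
      = A * (lop s + lop p - 2 *\<^sub>R t0) * B"
    unfolding cnj scaleR_2 by (simp add: algebra_simps mult.assoc)
  then show ?thesis
    unfolding SL_inv_def SR_inv_def A_def[symmetric] B_def[symmetric]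
      rscale_eq[of "A - B"] rscale_eq[of "_ - _"] lscale_eq[of "qcnj s" "A - B"] rhs .
qed

end
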